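(* For all $m\ge 3$, the Sperner systems $\mathcal{U}^{2m+1}_1$ and $\mathcal{U}^{2m+1}_2$ are strongly hypomorphic.
   Context: A set system over a finite set $A$ (the ground set) is a set of subsets of $A$, called blocks; it is a Sperner system if no block is included in another. Set systems $\mathcal A$ over $A$ and $\mathcal B$ over $B$ are isomorphic, $\mathcal A\equiv\mathcal B$, if there is a bijection $\sigma\colon A\to B$ with $\{\sigma(S):S\in\mathcal A\}=\mathcal B$. For a two-element subset $I$ of $A$, let $\theta_I$ be the equivalence relation on $A$ whose only nonsingleton class is $I$; for $S\subseteq A$ let $S_I=\{x/\theta_I:x\in S\}\subseteq A/\theta_I$; for a Sperner system $\mathcal A$ over $A$ let $\mathcal A_I=\{S_I:S\in\mathcal A\}$ and let $\mathcal A^*_I$ be the set of inclusion-minimal elements of $\mathcal A_I$, a Sperner system over $A/\theta_I$. Two Sperner systems $\mathcal A,\mathcal B$ over the same ground set $A$ are strongly hypomorphic if $\mathcal A^*_I\equiv\mathcal B^*_I$ for every two-element subset $I$ of $A$. Let $[m]=\{1,\dots,m\}$. For each $n\in[m]$ let $n'$ be a new element (a primed copy of $n$), and $S'=\{n':n\in S\}$ for $S\subseteq[m]$. Let $E_m=[m]\cup[m]'$, a set with $2m$ elements. Addition of elements of $[m]$ is modulo $m$ with result taken in $[m]$. For $J\subseteq[m]$ let $F^m_J=J\cup([m]\setminus J)'$. Put $\mathcal F^m_1=\{F^m_J: J\subseteq[m],\ |J|\text{ odd}\}$ and $\mathcal F^m_2=\{F^m_J: J\subseteq[m],\ |J|\text{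 even}\}$. For $p\in[m]$ let $G^m_p=E_m\setminus\{p,p',(p+1)'\}$ and $\mathcal G^m=\{G^m_p:p\in[m]\}$. For $i\in\{1,2\}$, $\mathcal M^m_i=\mathcal F^m_i\cup\mathcal G^m$, a Sperner system over $E_m$. Let $0$ be a further element not in $E_m$. For $m\ge3$ and $i\in\{1,2\}$, $\mathcal U^{2m+1}_i=\{S\cup\{0\}:S\in\mathcal M^m_i\}$, a Sperner system over $E_m\cup\{0\}$. *)

theory Defs
  imports Main
begin

text \<open>A set system is a ground set together with a set of blocks; the ground set is always
  passed explicitly, since it need not be the union of the blocks.\<close>

definition set_system :: "'a set \<Rightarrow> 'a set set \<Rightarrow> bool" where
  "set_system A \<A> \<longleftrightarrow> finite A \<and> (\<forall>S\<in>\<A>. S \<subseteq> A)"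

definition sperner_system :: "'a set \<Rightarrow> 'a set set \<Rightarrow> bool" where
  "sperner_system A \<A> \<longleftrightarrow> set_system A \<A> \<and> (\<forall>S\<in>\<A>. \<forall>T\<in>\<A>. S \<subseteq> T \<longrightarrow> S = T)"

definition isomorphic_systems :: "'a set \<Rightarrow> 'a set set \<Rightarrow> 'b set \<Rightarrow> 'b set set \<Rightarrow> bool" where
  "isomorphic_systems A \<A> B \<B> \<longleftrightarrow> (\<exists>\<sigma>. bij_betw \<sigma> A B \<and> {\<sigma> ` S | S. S \<in> \<A>} = \<B>)"

definition theta :: "'a set \<Rightarrow> 'a set \<Rightarrow> ('a \<times> 'a) set" where
  "theta A I = {(x, y). x \<in> A \<and> y \<in> A \<and> (x = y \<or> (x \<in> I \<and> y \<in> I))}"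

definition block_minor :: "'a set \<Rightarrow> 'a set \<Rightarrow> 'a set \<Rightarrow> 'a set set" where
  "block_minor A I S = {theta A I `` {x} | x. x \<in> S}"

definition system_minor :: "'a set \<Rightarrow> 'a set \<Rightarrow> 'a set set \<Rightarrow> 'a set set set" where
  "system_minor A I \<A> = {block_minor A I S | S. S \<in> \<A>}"

definition minimal_blocks :: "'a set set \<Rightarrow> 'a set set" where
  "minimal_blocks \<A> = {S \<in> \<A>. \<forall>T\<in>\<A>. T \<subseteq> S \<longrightarrow> T = S}"

definition sperner_minor :: "'a set \<Rightarrow> 'a set \<Rightarrow> 'a set set \<Rightarrow> 'a set set set" where
  "sperner_minor A I \<A> = minimal_blocks (system_minor A I \<A>)"

definition strongly_hypomorphic :: "'a set \<Rightarrow> 'a set set \<Rightarrow> 'a set set \<Rightarrow> bool" where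
  "strongly_hypomorphic A \<A> \<B> \<longleftrightarrow>
     sperner_system A \<A> \<and> sperner_system A \<B> \<and>
     (\<forall>I. I \<subseteq> A \<and> card I = 2 \<longrightarrow>
        isomorphic_systems (A // theta A I) (sperner_minor A I \<A>)
                           (A // theta A I) (sperner_minor A I \<B>))"

text \<open>Ground elements: \<open>Plain n\<close> is the element \<open>n\<close> of \<open>[m]\<close>, \<open>Primed n\<close> is its
  primed copy, and \<open>Zero\<close> is the further element \<open>0\<close>.\<close>

datatype elt = Plain nat | Primed nat | Zero

definition E :: "nat \<Rightarrow> elt set" where
  "E m = Plain ` {1..m} \<union> Primed ` {1..m}"

text \<open>Addition modulo \<open>m\<close> with the result in \<open>{1..m}\<close> rather than \<open>{0..<m}\<close>, for arguments
  in \<open>{1..m}\<close>; in particular \<open>m\<close> plus \<open>1\<close> is \<open>1\<close>.\<close>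

definition cyc_add :: "nat \<Rightarrow> nat \<Rightarrow> nat \<Rightarrow> nat" where
  "cyc_add m a b = (a + b - 1) mod m + 1"

definition F :: "nat \<Rightarrow> nat set \<Rightarrow> elt set" where
  "F m J = Plain ` J \<union> Primed ` ({1..m} - J)"

definition F1 :: "nat \<Rightarrow> elt set set" where
  "F1 m = {F m J | J. J \<subseteq> {1..m} \<and> odd (card J)}"

definition F2 :: "nat \<Rightarrow> elt set set" where
  "F2 m = {F m J | J. J \<subseteq> {1..m} \<and> even (card J)}"

definition G :: "nat \<Rightarrow> nat \<Rightarrow> elt set" where
  "G m p = E m - {Plain p, Primed p, Primed (cyc_add m p 1)}"

definition GG :: "nat \<Rightarrow> elt set set" where
  "GG m = {G m p | p. p \<in> {1..m}}"

definition M1 :: "nat \<Rightarrow> elt set set" where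
  "M1 m = F1 m \<union> GG m"

definition M2 :: "nat \<Rightarrow> elt set set" where
  "M2 m = F2 m \<union> GG m"

text \<open>\<open>U1 m\<close> and \<open>U2 m\<close> are the systems usually indexed by the size \<open>2m+1\<close> of their ground
  set \<open>E0 m\<close>; here the index is \<open>m\<close> itself.\<close>

definition E0 :: "nat \<Rightarrow> elt set" where
  "E0 m = E m \<union> {Zero}"

definition U1 :: "nat \<Rightarrow> elt set set" where
  "U1 m = {S \<union> {Zero} | S. S \<in> M1 m}"

definition U2 :: "nat \<Rightarrow> elt set set" where
  "U2 m = {S \<union> {Zero} | S. S \<in> M2 m}"

end

theory Submission
  imports Defs "HOL-Combinatorics.Transposition"
begin

text \<open>The transposition of \<open>k\<close> and \<open>k'\<close> exchanges the two families of blocks \<open>F\<^sub>J\<close> and fixes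
  every \<open>G\<^sub>q\<close> except for \<open>q + 1 = k\<close>. So it suffices to choose \<open>p\<close> such that \<open>I\<close> avoids
  \<open>p + 1\<close> and \<open>(p + 1)'\<close> and such that \<open>G\<^sub>p\<close> is redundant in both minors. If \<open>I = {a, b}\<close> with
  \<open>a\<close> one of \<open>p\<close>, \<open>p'\<close> and \<open>b\<close> outside \<open>{p, p', p + 1, (p + 1)'}\<close>, then \<open>G\<^sub>p\<close> contains \<open>b\<close>, and
  hence after the identification lies above every \<open>F\<^sub>J\<close> that contains \<open>a\<close> and \<open>p + 1\<close>; both
  parities of \<open>J\<close> occur. As \<open>m \<ge> 3\<close>, such a \<open>p\<close> exists unless \<open>I = {p, p'}\<close>, and in that
  case the two minors coincide.\<close>

section \<open>Minors under a permutation of the ground set\<close>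

lemma minimal_blocks_insert:
  assumes "x \<in> X" "x \<subseteq> g"
  shows "minimal_blocks (insert g X) = minimal_blocks X"
  using assms unfolding minimal_blocks_def by blast

text \<open>Injectivity on \<open>C\<close> is all that is available later: there \<open>f\<close>
  is the image map of a permutation of the ground set, and \<open>C\<close> is the set of
  classes.\<close>

lemma minimal_blocks_image:
  assumes "inj_on f C" and sub: "\<And>S. S \<in> \<A> \<Longrightarrow> S \<subseteq> C"
  shows "minimal_blocks ((`) f ` \<A>) = (`) f ` minimal_blocks \<A>"
proof -
  have eq: "f ` T = f ` S \<longleftrightarrow> T = S" if "S \<in> \<A>" "T \<in> \<A>" for S T
    using inj_on_image_eq_iff[OF assms(1)] sub that by auto
  have sub_iff: "f ` T \<subseteq> f ` S \<longleftrightarrow> T \<subseteq> S" if "S \<in> \<A>" "T \<in> \<A>" for S T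
  proof
    assume *: "f ` T \<subseteq> f ` S"
    show "T \<subseteq> S"
    proof
      fix x
      assume "x \<in> T"
      with * have "f x \<in> f ` S"
        by blast
      then show "x \<in> S"
        using inj_on_image_mem_iff[OF assms(1)] sub[OF that(1)] sub[OF that(2)] \<open>x \<in> T\<close> by blast
    qed
  qed auto
  have "minimal_blocks ((`) f ` \<A>)
      = (`) f ` {S \<in> \<A>. \<forall>T\<in>\<A>. f ` T \<subseteq> f ` S \<longrightarrow> f ` T = f ` S}"
    by (simp only: minimal_blocks_def Compr_image_eq ball_simps)
  also have "{S \<in> \<A>. \<forall>T\<in>\<A>. f ` T \<subseteq> f ` S \<longrightarrow> f ` T = f ` S} = minimal_blocks \<A>"
    unfolding minimal_blocks_def
    by (intro Collect_cong conj_cong ball_cong refl) (simp add: eq sub_iff)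
  finally show ?thesis .
qed

lemma block_minor_eq_image: "block_minor A I S = (\<lambda>x. theta A I `` {x}) ` S"
  unfolding block_minor_def by auto

lemma system_minor_eq_image: "system_minor A I \<A> = block_minor A I ` \<A>"
  unfolding system_minor_def by auto

lemma theta_class:
  "x \<in> A \<Longrightarrow> theta A I `` {x} = (if x \<in> I then A \<inter> I else {x})"
  unfolding theta_def by auto

lemma block_minor_subset_quotient: "S \<subseteq> A \<Longrightarrow> block_minor A I S \<subseteq> A // theta A I"
  unfolding block_minor_def quotient_def by auto

lemma theta_class_image:
  assumes \<sigma>: "bij_betw \<sigma> A A" and I: "I \<subseteq> A" "\<sigma> ` I = I" and x: "x \<in> A"
  shows "theta A I `` {\<sigma> x} = \<sigma> ` (theta A I `` {x})"
proof -
  have "\<sigma> x \<in> A"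
    using \<sigma> x by (auto simp: bij_betw_def)
  moreover have "\<sigma> x \<in> I \<longleftrightarrow> x \<in> I"
    using \<sigma> I x inj_on_image_mem_iff[of \<sigma> A x I] by (auto simp: bij_betw_def)
  moreover have "A \<inter> I = I"
    using I by auto
  ultimately show ?thesis
    using I x by (simp add: theta_class)
qed

text \<open>As \<sigma> preserves \<open>I\<close>, it maps classes to classes. The induced
  bijection of the quotient commutes with \<open>block_minor\<close> and preserves inclusion, hence
  also minimality.\<close>

lemma isomorphic_sperner_minor:
  assumes \<sigma>: "bij_betw \<sigma> A A" and I: "I \<subseteq> A" "\<sigma> ` I = I"
    and sub: "\<And>S. S \<in> \<A> \<Longrightarrow> S \<subseteq> A" and img: "(`) \<sigma> ` \<A> = \<B>"
  shows "isomorphic_systems (A // theta A I) (sperner_minor A I \<A>)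
    (A // theta A I) (sperner_minor A I \<B>)"
proof -
  let ?Q = "A // theta A I"
  have "?Q \<subseteq> Pow A"
    unfolding quotient_def theta_def by auto
  then have inj: "inj_on ((`) \<sigma>) ?Q"
    using \<sigma> by (meson bij_betw_def inj_on_image_Pow inj_on_subset)
  have "(`) \<sigma> ` ?Q = (\<lambda>x. theta A I `` {\<sigma> x}) ` A"
    by (auto simp: quotient_def theta_class_image[OF \<sigma> I] image_iff)
  also have "\<dots> = (\<lambda>x. theta A I `` {x}) ` \<sigma> ` A"
    by (simp add: image_image)
  also have "\<dots> = ?Q"
    using \<sigma> by (auto simp: bij_betw_def quotient_def)
  finally have bij: "bij_betw ((`) \<sigma>) ?Q ?Q"
    using inj by (simp add: bij_betw_def)
  have block: "block_minor A I (\<sigma> ` S) = (`) \<sigma> ` block_minor A I S" if "S \<in> \<A>" for S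
  proof -
    have "block_minor A I (\<sigma> ` S) = (\<lambda>x. theta A I `` {\<sigma> x}) ` S"
      by (simp only: block_minor_eq_image image_image)
    also have "\<dots> = (\<lambda>x. \<sigma> ` (theta A I `` {x})) ` S"
      by (rule image_cong[OF refl], rule theta_class_image[OF \<sigma> I]) (use sub[OF that] in blast)
    also have "\<dots> = (`) \<sigma> ` block_minor A I S"
      by (simp only: block_minor_eq_image image_image)
    finally show ?thesis .
  qed
  have "system_minor A I \<B> = (\<lambda>S. block_minor A I (\<sigma> ` S)) ` \<A>"
    by (simp only: system_minor_eq_image img[symmetric] image_image)
  also have "\<dots> = (\<lambda>S. (`) \<sigma> ` block_minor A I S) ` \<A>"
    by (rule image_cong[OF refl block])
  also have "\<dots> = (`) ((`) \<sigma>) ` system_minor A I \<A>"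
    by (simp only: system_minor_eq_image image_image)
  finally have "system_minor A I \<B> = (`) ((`) \<sigma>) ` system_minor A I \<A>" .
  moreover have "minimal_blocks ((`) ((`) \<sigma>) ` system_minor A I \<A>)
      = (`) ((`) \<sigma>) ` minimal_blocks (system_minor A I \<A>)"
    using block_minor_subset_quotient sub
    by (intro minimal_blocks_image[OF inj]) (auto simp: system_minor_eq_image)
  ultimately have "sperner_minor A I \<B> = (`) ((`) \<sigma>) ` sperner_minor A I \<A>"
    unfolding sperner_minor_def by simp
  then have "{(`) \<sigma> ` S | S. S \<in> sperner_minor A I \<A>} = sperner_minor A I \<B>"
    by (simp only: Setcompr_eq_image)
  with bij show ?thesis
    unfolding isomorphic_systems_def by (intro exI[of _ "(`) \<sigma>"] conjI)
qed

section \<open>The two systems and their Sperner property\<close>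

definition parity_system :: "nat \<Rightarrow> bool \<Rightarrow> nat set \<Rightarrow> elt set set" where
  "parity_system m b Q =
     {insert Zero (F m J) | J. J \<subseteq> {1..m} \<and> (odd (card J) \<longleftrightarrow> b)} \<union> (\<lambda>q. insert Zero (G m q)) ` Q"

lemma U1_eq: "U1 m = parity_system m True {1..m}"
  by (simp only: U1_def M1_def F1_def GG_def parity_system_def setcompr_eq_image image_Un image_image
      Collect_mem_eq Un_insert_right Un_empty_right simp_thms)

lemma U2_eq: "U2 m = parity_system m False {1..m}"
  by (simp only: U2_def M2_def F2_def GG_def parity_system_def setcompr_eq_image image_Un image_image
      Collect_mem_eq Un_insert_right Un_empty_right simp_thms)

text \<open>This is why the index set \<open>Q\<close> is a parameter: a redundant
  \<open>G m p\<close> can be split off while the rest stays in the same family.\<close>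

lemma parity_system_insert:
  "parity_system m b (insert p Q) = insert (insert Zero (G m p)) (parity_system m b Q)"
  by (simp add: parity_system_def)

lemma parity_system_subset: "S \<in> parity_system m b Q \<Longrightarrow> S \<subseteq> E0 m"
  unfolding parity_system_def F_def G_def E_def E0_def by auto

text \<open>The form \<open>Suc 0\<close> matches what the simplifier makes of
  \<open>1\<close>.\<close>

lemma cyc_add_one: "p \<in> {1..m} \<Longrightarrow> cyc_add m p (Suc 0) = (if p = m then 1 else p + 1)"
  unfolding cyc_add_def by auto

lemma inj_on_cyc_add_one: "inj_on (\<lambda>p. cyc_add m p 1) {1..m}"
proof (rule inj_onI)
  fix x y
  assume xy: "x \<in> {1..m}" "y \<in> {1..m}" and "cyc_add m x 1 = cyc_add m y 1"
  then have "(if x = m then 1 else x + 1) = (if y = m then 1 else y + 1)"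
    by (simp only: One_nat_def cyc_add_one[OF xy(1)] cyc_add_one[OF xy(2)])
  with xy show "x = y"
    by (cases "x = m"; cases "y = m") simp_all
qed

text \<open>Serves to find an index other than \<open>p\<close> and
  \<open>cyc_add m p 1\<close>.\<close>

lemma ex_third:
  fixes x y m :: nat
  assumes "m \<ge> 3"
  obtains r where "r \<in> {1..m}" "r \<noteq> x" "r \<noteq> y"
proof -
  have "card ({1..m} - {x, y}) \<ge> card {1..m} - card {x, y}"
    by (rule diff_card_le_card_Diff) simp
  moreover have "card {x, y} \<le> 2"
    by (simp add: card_insert_if)
  ultimately have "card ({1..m} - {x, y}) > 0"
    using assms by simp
  then have "{1..m} - {x, y} \<noteq> {}"
    by (metis card.empty less_irrefl)
  then show thesis
    using that by blast
qed

text \<open>Every \<open>F m J\<close> contains exactly one of \<open>Plain n\<close>,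
  \<open>Primed n\<close> for each index \<open>n\<close>, whereas \<open>G m q\<close> contains
  neither for \<open>n = q\<close> and both for a third index. Among themselves, the
  \<open>G m q\<close> are told apart by the only unprimed element that each omits.\<close>

lemma sperner_parity_system:
  assumes "m \<ge> 3"
  shows "sperner_system (E0 m) (parity_system m b {1..m})"
proof -
  have finite: "finite (E0 m)"
    unfolding E0_def E_def by auto
  have antichain: "S = T" if "S \<in> parity_system m b {1..m}" "T \<in> parity_system m b {1..m}" "S \<subseteq> T" for S T
  proof -
    have FF: "J = K" if "J \<subseteq> {1..m}" "K \<subseteq> {1..m}" "insert Zero (F m J) \<subseteq> insert Zero (F m K)" for J K
    proof -
      have "F m J \<subseteq> F m K"
        using that unfolding F_def by auto
      then have "J \<subseteq> K" "{1..m} - J \<subseteq> {1..m} - K"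
        unfolding F_def by blast+
      then show ?thesis
        using that by blast
    qed
    have FG: False if "q \<in> {1..m}" "insert Zero (F m J) \<subseteq> insert Zero (G m q)" for J q
    proof -
      have "Plain q \<in> F m J \<or> Primed q \<in> F m J"
        using that unfolding F_def by blast
      then show False
        using that unfolding G_def by auto
    qed
    have GF: False if "q \<in> {1..m}" "insert Zero (G m q) \<subseteq> insert Zero (F m J)" for J q
    proof -
      obtain r where "r \<in> {1..m}" "r \<noteq> q" "r \<noteq> cyc_add m q 1"
        using ex_third[OF assms] .
      then have "Plain r \<in> G m q" "Primed r \<in> G m q"
        unfolding G_def E_def by auto
      then show False
        using that unfolding F_def by blast
    qed
    have GG: "q = r" if "q \<in> {1..m}" "r \<in> {1..m}" "insert Zero (G m q) \<subseteq> insert Zero (G m r)" for q r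
    proof (rule ccontr)
      assume "q \<noteq> r"
      then have "Plain r \<in> G m q"
        using that unfolding G_def E_def by auto
      then show False
        using that unfolding G_def by auto
    qed
    have blocks: "(\<exists>J. J \<subseteq> {1..m} \<and> S = insert Zero (F m J)) \<or> (\<exists>q. q \<in> {1..m} \<and> S = insert Zero (G m q))"
      if "S \<in> parity_system m b {1..m}" for S
      using that unfolding parity_system_def by blast
    from blocks[OF that(1)] blocks[OF that(2)] that(3) show "S = T"
      by (elim disjE exE conjE) (metis FF, metis FG, metis GF, metis GG)
  qed
  show ?thesis
    unfolding sperner_system_def set_system_def
    by (intro conjI ballI impI) (rule finite, erule parity_system_subset, rule antichain)
qed

section \<open>Exchanging k and k'\<close>

definition toggle :: "nat \<Rightarrow> nat set \<Rightarrow> nat set" where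
  "toggle k J = (if k \<in> J then J - {k} else insert k J)"

lemma toggle_subset: "J \<subseteq> A \<Longrightarrow> k \<in> A \<Longrightarrow> toggle k J \<subseteq> A"
  unfolding toggle_def by auto

lemma odd_card_toggle: "finite J \<Longrightarrow> odd (card (toggle k J)) \<longleftrightarrow> even (card J)"
  by (cases "k \<in> J") (auto simp: toggle_def)

lemma transpose_F:
  assumes "k \<in> {1..m}"
  shows "transpose (Plain k) (Primed k) ` F m J = F m (toggle k J)"
proof -
  have "transpose (Plain k) (Primed k) ` F m J \<subseteq> F m (toggle k J)" for J
    using assms unfolding F_def toggle_def by (auto simp: transpose_def)
  \<comment> \<open>Both the transposition and \<open>toggle k\<close> are involutions, so the
    inclusion for \<open>toggle k J\<close> yields the reverse one for \<open>J\<close>.\<close>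
  from this[of J] image_mono[OF this[of "toggle k J"], of "transpose (Plain k) (Primed k)"]
  show ?thesis
    by (auto simp: image_image toggle_def insert_absorb split: if_splits)
qed

text \<open>\<open>Plain k\<close> and \<open>Primed k\<close> are either both in
  \<open>G m q\<close> or both outside; only the index \<open>cyc_add m q 1\<close> can break this
  symmetry.\<close>

lemma transpose_G:
  assumes "k \<noteq> cyc_add m q 1"
  shows "transpose (Plain k) (Primed k) ` G m q = G m q"
  using assms unfolding G_def E_def by (intro transpose_image_eq) auto

lemma transpose_parity_system:
  assumes k: "k \<in> {1..m}" and Q: "\<And>q. q \<in> Q \<Longrightarrow> k \<noteq> cyc_add m q 1"
  shows "(`) (transpose (Plain k) (Primed k)) ` parity_system m b Q = parity_system m (\<not> b) Q"
proof -
  let ?\<tau> = "transpose (Plain k) (Primed k)"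
  \<comment> \<open>Needed for both parities: the opposite one, combined with the involution, gives
    the reverse inclusion.\<close>
  have sub: "(`) ?\<tau> ` parity_system m b Q \<subseteq> parity_system m (\<not> b) Q" for b
  proof -
    have "?\<tau> ` insert Zero (F m J) \<in> parity_system m (\<not> b) Q"
      if "J \<subseteq> {1..m}" "odd (card J) \<longleftrightarrow> b" for J
      using that toggle_subset[OF that(1) k] odd_card_toggle[of J k] finite_subset[OF that(1)]
      unfolding parity_system_def by (auto simp: transpose_F[OF k])
    moreover have "?\<tau> ` insert Zero (G m q) \<in> parity_system m (\<not> b) Q" if "q \<in> Q" for q
      using that Q unfolding parity_system_def by (auto simp: transpose_G)
    ultimately show ?thesis
      unfolding parity_system_def[of m b] by blast
  qed
  have "S \<in> (`) ?\<tau> ` parity_system m b Q" if "S \<in> parity_system m (\<not> b) Q" for S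
  proof
    show "S = ?\<tau> ` ?\<tau> ` S"
      by (simp add: image_image)
    show "?\<tau> ` S \<in> parity_system m b Q"
      using sub[of "\<not> b"] that by auto
  qed
  with sub show ?thesis
    by blast
qed

section \<open>Redundancy of a block G in a minor\<close>

lemma block_minor_subset_of_identified:
  assumes "{a, b} \<subseteq> A" "S \<subseteq> insert a T" "b \<in> T"
  shows "block_minor A {a, b} S \<subseteq> block_minor A {a, b} T"
proof -
  have "theta A {a, b} `` {a} = theta A {a, b} `` {b}"
    using assms(1) by (simp add: theta_class)
  then show ?thesis
    using assms unfolding block_minor_eq_image by blast
qed

lemma sperner_minor_drop_G:
  assumes p: "p \<in> {1..m}" and r: "r \<in> {1..m}" "r \<noteq> p" "r \<noteq> cyc_add m p 1" and m: "m \<ge> 3"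
    and a: "a = Plain p \<or> a = Primed p" and b: "b = Zero \<or> b = Plain r \<or> b = Primed r"
  shows "sperner_minor (E0 m) {a, b} (parity_system m c {1..m})
    = sperner_minor (E0 m) {a, b} (parity_system m c ({1..m} - {p}))"
proof -
  let ?s = "cyc_add m p 1"
  have s: "?s \<in> {1..m}" "?s \<noteq> p"
    using p m by (auto simp: cyc_add_one)
  \<comment> \<open>\<open>F m J\<^sub>0\<close> contains \<open>a\<close> and
    \<open>Plain ?s\<close>. If its parity is wrong, toggling \<open>r\<close> corrects it without
    affecting these two elements, as \<open>r\<close> differs from \<open>p\<close> and
    \<open>?s\<close>.\<close>
  define J\<^sub>0 where "J\<^sub>0 = (if a = Plain p then {p, ?s} else {?s})"
  define J where "J = (if odd (card J\<^sub>0) \<longleftrightarrow> c then J\<^sub>0 else toggle r J\<^sub>0)"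
  have J0: "J\<^sub>0 \<subseteq> {1..m}"
    using p s by (auto simp: J\<^sub>0_def)
  have J: "J \<subseteq> {1..m}" "odd (card J) \<longleftrightarrow> c"
    using toggle_subset[OF J0 r(1)] odd_card_toggle[of J\<^sub>0 r] finite_subset[OF J0] J0
    unfolding J_def by auto
  have sJ: "?s \<in> J" and pJ: "p \<in> J \<longleftrightarrow> a = Plain p"
    using r s unfolding J_def J\<^sub>0_def toggle_def by auto
  \<comment> \<open>Of the three elements that \<open>G m p\<close> omits, \<open>F m J\<close>
    contains only \<open>a\<close>: it has \<open>Plain ?s\<close> instead of
    \<open>Primed ?s\<close>.\<close>
  have "F m J \<subseteq> insert a (G m p)"
    using sJ pJ a J(1) unfolding F_def G_def E_def by auto
  moreover have "b \<in> insert Zero (G m p)"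
    using b r unfolding G_def E_def by auto
  moreover have "{a, b} \<subseteq> E0 m"
    using a b p r unfolding E0_def E_def by auto
  ultimately have "block_minor (E0 m) {a, b} (insert Zero (F m J))
      \<subseteq> block_minor (E0 m) {a, b} (insert Zero (G m p))"
    by (intro block_minor_subset_of_identified) auto
  moreover have "insert Zero (F m J) \<in> parity_system m c ({1..m} - {p})"
    using J unfolding parity_system_def by auto
  moreover have "parity_system m c {1..m} = insert (insert Zero (G m p)) (parity_system m c ({1..m} - {p}))"
    using p by (simp only: parity_system_insert[symmetric] insert_Diff)
  \<comment> \<open>Should the two block minors be equal, removing \<open>G m p\<close> is still
    harmless, because the same minor remains as that of \<open>F m J\<close>.\<close>
  ultimately show ?thesis
    unfolding sperner_minor_def system_minor_eq_image
    by (simp only: image_insert) (rule minimal_blocks_insert[OF imageI])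
qed

lemma isomorphic_minors_distinct_index:
  assumes p: "p \<in> {1..m}" and r: "r \<in> {1..m}" "r \<noteq> p" "r \<noteq> cyc_add m p 1" and m: "m \<ge> 3"
    and a: "a = Plain p \<or> a = Primed p" and b: "b = Zero \<or> b = Plain r \<or> b = Primed r"
  shows "isomorphic_systems
    (E0 m // theta (E0 m) {a, b}) (sperner_minor (E0 m) {a, b} (U1 m))
    (E0 m // theta (E0 m) {a, b}) (sperner_minor (E0 m) {a, b} (U2 m))"
proof -
  let ?s = "cyc_add m p 1"
  let ?\<tau> = "transpose (Plain ?s) (Primed ?s)"
  have s: "?s \<in> {1..m}" "?s \<noteq> p"
    using p m by (auto simp: cyc_add_one)
  \<comment> \<open>By injectivity of the cyclic successor, \<open>p\<close> is the only index whose
    block \<open>G\<close> is not symmetric under \<open>?\<tau>\<close>, and it has been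
    removed.\<close>
  have "(`) ?\<tau> ` parity_system m True ({1..m} - {p}) = parity_system m (\<not> True) ({1..m} - {p})"
    using inj_on_cyc_add_one[of m] p
    by (intro transpose_parity_system[OF s(1)]) (auto dest: inj_onD)
  moreover have "bij_betw ?\<tau> (E0 m) (E0 m)"
    using s by (auto simp: bij_betw_def E0_def E_def transpose_image_eq)
  moreover have "{a, b} \<subseteq> E0 m"
    using a b p r unfolding E0_def E_def by auto
  moreover have "?\<tau> ` {a, b} = {a, b}"
    using a b r s by auto
  ultimately show ?thesis
    unfolding U1_eq U2_eq sperner_minor_drop_G[OF assms]
    by (intro isomorphic_sperner_minor[of ?\<tau>]) (auto dest: parity_system_subset)
qed

section \<open>Identifying p with p'\<close>

lemma system_minor_same_index_subset:
  assumes p: "p \<in> {1..m}"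
  shows "system_minor (E0 m) {Plain p, Primed p} (parity_system m b Q)
    \<subseteq> system_minor (E0 m) {Plain p, Primed p} (parity_system m (\<not> b) Q)"
proof -
  let ?\<mu> = "block_minor (E0 m) {Plain p, Primed p}"
  have I: "{Plain p, Primed p} \<subseteq> E0 m"
    using p unfolding E0_def E_def by auto
  have eq: "theta (E0 m) {Plain p, Primed p} `` {Plain p} = theta (E0 m) {Plain p, Primed p} `` {Primed p}"
    using I by (simp add: theta_class)
  \<comment> \<open>The transposition moves elements only within their classes, so \<open>J\<close>
    and \<open>toggle p J\<close>, of opposite parities, give the same block minor.\<close>
  have "?\<mu> (insert Zero (F m J)) \<in> ?\<mu> ` parity_system m (\<not> b) Q"
    if J: "J \<subseteq> {1..m}" "odd (card J) \<longleftrightarrow> b" for J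
  proof
    let ?\<tau> = "transpose (Plain p) (Primed p)"
    have "theta (E0 m) {Plain p, Primed p} `` {?\<tau> x} = theta (E0 m) {Plain p, Primed p} `` {x}" for x
      using eq by (simp add: transpose_def)
    then have "?\<mu> (?\<tau> ` insert Zero (F m J)) = ?\<mu> (insert Zero (F m J))"
      by (simp only: block_minor_eq_image image_image)
    then show "?\<mu> (insert Zero (F m J)) = ?\<mu> (insert Zero (F m (toggle p J)))"
      by (simp add: transpose_F[OF p])
    show "insert Zero (F m (toggle p J)) \<in> parity_system m (\<not> b) Q"
      using toggle_subset[OF J(1) p] odd_card_toggle[of J p] finite_subset[OF J(1)] J
      unfolding parity_system_def by auto
  qed
  moreover have "?\<mu> (insert Zero (G m q)) \<in> ?\<mu> ` parity_system m (\<not> b) Q" if "q \<in> Q" for q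
    using that unfolding parity_system_def by blast
  ultimately show ?thesis
    unfolding system_minor_eq_image parity_system_def[of m b] by blast
qed

lemma isomorphic_systems_refl: "isomorphic_systems A \<A> A \<A>"
  unfolding isomorphic_systems_def by (rule exI[of _ id]) auto

lemma isomorphic_minors_same_index:
  assumes "p \<in> {1..m}"
  shows "isomorphic_systems
    (E0 m // theta (E0 m) {Plain p, Primed p}) (sperner_minor (E0 m) {Plain p, Primed p} (U1 m))
    (E0 m // theta (E0 m) {Plain p, Primed p}) (sperner_minor (E0 m) {Plain p, Primed p} (U2 m))"
proof -
  have "system_minor (E0 m) {Plain p, Primed p} (U1 m) = system_minor (E0 m) {Plain p, Primed p} (U2 m)"
    using system_minor_same_index_subset[OF assms, of True] system_minor_same_index_subset[OF assms, of False]
    unfolding U1_eq U2_eq by auto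
  then show ?thesis
    by (simp add: sperner_minor_def isomorphic_systems_refl)
qed

section \<open>All two-element sets I\<close>

theorem proposition3p19:
  fixes m :: nat
  assumes "m \<ge> 3"
  shows "strongly_hypomorphic (E0 m) (U1 m) (U2 m)"
proof -
  let ?iso = "\<lambda>I. isomorphic_systems (E0 m // theta (E0 m) I) (sperner_minor (E0 m) I (U1 m))
    (E0 m // theta (E0 m) I) (sperner_minor (E0 m) I (U2 m))"
  have zero: "?iso {a, Zero}" if "p \<in> {1..m}" "a = Plain p \<or> a = Primed p" for a p
    using isomorphic_minors_distinct_index ex_third[OF assms] that assms by metis
  have main: "?iso {a, b}"
    if pq: "p \<in> {1..m}" "a = Plain p \<or> a = Primed p" "q \<in> {1..m}" "b = Plain q \<or> b = Primed q" "a \<noteq> b"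
    for a b p q
  proof -
    \<comment> \<open>Two indices that are successors of each other would force \<open>m\<close> to
      divide 2. So, for distinct indices, \<open>a\<close> or \<open>b\<close> can take the role of
      the element with index \<open>p\<close>.\<close>
    have "\<not> (q = cyc_add m p 1 \<and> p = cyc_add m q 1)"
      using assms pq(1,3) by (simp add: cyc_add_one)
    then consider "p = q" | "p \<noteq> q" "q \<noteq> cyc_add m p 1" | "p \<noteq> q" "p \<noteq> cyc_add m q 1"
      by blast
    then show ?thesis
    proof cases
      case 1
      then have "{a, b} = {Plain p, Primed p}"
        using pq by auto
      then show ?thesis
        using isomorphic_minors_same_index pq by metis
    next
      case 2
      then show ?thesis
        using isomorphic_minors_distinct_index[of p m q a b] pq assms by auto
    next
      case 3
      then show ?thesis
        using isomorphic_minors_distinct_index[of q m p b a] pq assms by (auto simp: insert_commute)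
    qed
  qed
  have "?iso I" if I: "I \<subseteq> E0 m" "card I = 2" for I
  proof -
    obtain a b where ab: "I = {a, b}" "a \<noteq> b"
      using I by (auto simp: card_2_iff)
    have E0: "x = Zero \<or> (\<exists>p\<in>{1..m}. x = Plain p \<or> x = Primed p)" if "x \<in> E0 m" for x
      using that unfolding E0_def E_def by auto
    have "a \<in> E0 m" "b \<in> E0 m"
      using I ab by auto
    then consider p where "a = Zero" "p \<in> {1..m}" "b = Plain p \<or> b = Primed p"
      | p where "b = Zero" "p \<in> {1..m}" "a = Plain p \<or> a = Primed p"
      | p q where "p \<in> {1..m}" "a = Plain p \<or> a = Primed p" "q \<in> {1..m}" "b = Plain q \<or> b = Primed q"
      using E0 ab(2) by metis
    then show ?thesis
    proof cases
      case 1
      then show ?thesis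
        using zero[of p b] ab by (simp add: insert_commute)
    next
      case 2
      then show ?thesis
        using zero[of p a] ab by simp
    next
      case 3
      then show ?thesis
        using main[of p a q b] ab by simp
    qed
  qed
  then have "\<forall>I. I \<subseteq> E0 m \<and> card I = 2 \<longrightarrow> ?iso I"
    by simp
  then show ?thesis
    unfolding strongly_hypomorphic_def U1_eq U2_eq
    by (intro conjI sperner_parity_system[OF assms])
qed

end
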